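(* The CIS synthesis process for the ReLU neural network dynamical system $f$ terminates after finitely many steps (it is finitely determined). In particular, the set recursion $\tilde{\mathcal{A}}_{i+1}(\mathcal{X}_s)=\mathcal{Q}(\tilde{\mathcal{A}}_i(\mathcal{X}_s),\tilde{\mathcal{A}}_i(\mathcal{X}_s))$, $\tilde{\mathcal{A}}_0(\mathcal{X}_s)=\mathcal{X}_s^\Delta$, stopped as soon as $\tilde{\mathcal{A}}_{i+1}(\mathcal{X}_s)=\tilde{\mathcal{A}}_i(\mathcal{X}_s)$, terminates within $N_T=|\Delta(\mathcal{X}_s^\Delta)|+1$ iterations, where $|\Delta(\mathcal{X}_s^\Delta)|$ is the cardinality of the index set $\Delta(\mathcal{X}_s^\Delta)\subseteq\{1,\dots,n_\Delta\}$.
   Context: Vector inequalities and maxima are element-wise; $[a,b]$ and $]a,b[$ are closed/open hyperboxes; "hyperbox" means closed; $\mathrm{Diag}(x)$ is the diagonal matrix with diagonal $x$. Network: $\ell\ge2$, $n_0=n_x+n_u$, $n_\ell=n_x$, $W^{(i)}\in\mathbb{R}^{n_i\times n_{i-1}}$, $B^{(i)}\in\mathbb{R}^{n_i}$. $x_{k+1}=f(x_k,u_k)$: $z^{(0)}=[x_k^T,u_k^T]^T$, $\hat z^{(i)}=W^{(i)}z^{(i-1)}+B^{(i)}$, $z^{(i)}=\max\{0,\hat z^{(i)}\}$ ($i=1,\dots,\ell-1$), $x_{k+1}=W^{(\ell)}z^{(\ell-1)}+B^{(\ell)}$. $\mathcal{X}=[\underline{x},\overline{x}]\subset\mathbb{R}^{n_x}$,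 $\mathcal{U}=[\underline{u},\overline{u}]\subset\mathbb{R}^{n_u}$ are bounded hyperboxes, $f:\mathcal{X}\times\mathcal{U}\to\mathcal{X}$, and the safe set $\mathcal{X}_s\subseteq\mathcal{X}$ has non-empty interior. Quantization: fix $d_{\min}>0$. Basis hyperboxes $\mathcal{X}_\Delta^{(1)},\dots,\mathcal{X}_\Delta^{(n_\Delta)}$ are the boxes $\prod_{j=1}^{n_x}[\underline{x}_j+k_jd_{\min},\min\{\underline{x}_j+(k_j+1)d_{\min},\overline{x}_j\}]$, $k_j\in\{0,\dots,\lceil(\overline{x}_j-\underline{x}_j)/d_{\min}\rceil-1\}$; they cover $\mathcal{X}$ and have disjoint interiors. $\mathcal{P}_\cup(\mathcal{X}_\Delta)$ is the collection of all unions (including the empty one) of basis hyperboxes; for $\mathcal{S}\in\mathcal{P}_\cup(\mathcal{X}_\Delta)$, $\Delta(\mathcal{S})\subseteq\{1,\dots,n_\Delta\}$ is the unique index set with $\mathcal{S}=\bigcup_{j\in\Delta(\mathcal{S})}\mathcal{X}_\Delta^{(j)}$. The quantized safe set is $\mathcal{X}_s^\Delta=\bigcup_{i=1}^{n_s}\mathcal{X}_s^{(i)}\subseteq\mathcal{X}_s$, each $\mathcal{X}_s^{(i)}\subseteq\mathcal{X}_s$ a hyperbox in $\mathcal{P}_\cup(\mathcal{X}_\Delta)$. Interval reachability: $\texttt{lin\_layer}(a,b;W,B)=[\hat a,\hat b]$ with $\hat a_j=\sum_{q:W_{jq}\ge0}W_{jq}a_q+\sum_{q:W_{jq}<0}W_{jq}b_q+B_j$,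 $\hat b_j=\sum_{q:W_{jq}\ge0}W_{jq}b_q+\sum_{q:W_{jq}<0}W_{jq}a_q+B_j$. For hyperboxes $[x_l,x_u],[u_l,u_u]$, $\texttt{reachable\_hyperboxes}([x_l,x_u],[u_l,u_u])=\{[\hat a^{(i)},\hat b^{(i)}]\}_{i=1}^\ell$ with $a^{(0)}=[x_l^T,u_l^T]^T$, $b^{(0)}=[x_u^T,u_u^T]^T$, $[\hat a^{(i)},\hat b^{(i)}]=\texttt{lin\_layer}(a^{(i-1)},b^{(i-1)};W^{(i)},B^{(i)})$, $a^{(i)}=\max\{0,\hat a^{(i)}\}$, $b^{(i)}=\max\{0,\hat b^{(i)}\}$; $\bar{\mathcal{F}}([x_l,x_u],[u_l,u_u])=[\hat a^{(\ell)},\hat b^{(\ell)}]$. Set $\{[\underline{\hat z}^{(i)},\overline{\hat z}^{(i)}]\}_{i=1}^\ell=\texttt{reachable\_hyperboxes}(\mathcal{X},\mathcal{U})$. MILC-OP for a hyperbox $\mathcal{I}=[\underline{x}_k,\overline{x}_k]\subseteq\mathcal{X}$ and $\mathcal{T}=\mathcal{X}\setminus\bigcup_{m=1}^{n_o}]\underline{o}^{(m)},\overline{o}^{(m)}[$ (non-empty open hyperboxes): arbitrary objective; it has a solution iff there are values with (1) $a^{(0)}=[\underline{x}_k^T,u_k^T]^T$, $b^{(0)}=[\overline{x}_k^T,u_k^T]^T$, $\underline{u}\le u_k\le\overline{u}$; (2) $[\hat a^{(i)},\hat b^{(i)}]=\texttt{lin\_layer}(a^{(i-1)},b^{(i-1)};W^{(i)},B^{(i)})$,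 $\underline{\hat z}^{(i)}\le\hat a^{(i)}\le\hat b^{(i)}\le\overline{\hat z}^{(i)}$, $1\le i\le\ell$; (3) for $1\le i\le\ell-1$: $\alpha^{(i)},\beta^{(i)},\gamma^{(i)}\in\{0,1\}^{n_i}$, $\alpha^{(i)}_j+\beta^{(i)}_j+\gamma^{(i)}_j=1$, $a^{(i)}\ge\hat a^{(i)}$, $a^{(i)}\le\mathrm{Diag}(\overline{\hat z}^{(i)})\gamma^{(i)}$, $a^{(i)}\le\hat a^{(i)}-\mathrm{Diag}(\underline{\hat z}^{(i)})(\alpha^{(i)}+\beta^{(i)})$, $b^{(i)}\ge\hat b^{(i)}$, $b^{(i)}\le\hat b^{(i)}-\mathrm{Diag}(\underline{\hat z}^{(i)})\alpha^{(i)}$, $b^{(i)}\le\mathrm{Diag}(\overline{\hat z}^{(i)})(\beta^{(i)}+\gamma^{(i)})$, $0\le a^{(i)}\le b^{(i)}$; (4) $\underline{x}_{k+1}=\hat a^{(\ell)}$, $\overline{x}_{k+1}=\hat b^{(\ell)}$; (5) for $1\le m\le n_o$: $\phi^{(m)},\psi^{(m)}\in\{0,1\}^{n_x}$, $\phi^{(m)}_j+\psi^{(m)}_j\le1$, $\sum_j(\phi^{(m)}_j+\psi^{(m)}_j)\ge1$, $\overline{x}_{k+1}\le\overline{x}+\mathrm{Diag}(\underline{o}^{(m)}-\overline{x})\phi^{(m)}$, $\overline{x}_{k+1}\ge\underline{o}^{(m)}-\mathrm{Diag}(\underline{o}^{(m)}-\underline{x})\phi^{(m)}$, $\underline{x}_{k+1}\ge\underline{x}+\mathrm{Diag}(\overline{o}^{(m)}-\underline{x})\psi^{(m)}$,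 $\underline{x}_{k+1}\le\overline{o}^{(m)}-\mathrm{Diag}(\overline{o}^{(m)}-\overline{x})\psi^{(m)}$. CIS synthesis process. Sets in $\mathcal{P}_\cup(\mathcal{X}_\Delta)$ are stored as finite lists of hyperboxes from $\mathcal{P}_\cup(\mathcal{X}_\Delta)$. Verification of a list $\mathcal{I}$ against target $\mathcal{T}$: a hyperbox $\mathcal{I}_i$ of the list is put into $\mathcal{I}^-$ if $\bar{\mathcal{F}}(\mathcal{I}_i,\mathcal{U})\cap\mathcal{T}=\varnothing$; otherwise it is put into $\mathcal{I}^+$ if MILC-OP for $(\mathcal{I}_i,\mathcal{T})$ has a solution, and into $\mathcal{I}^-$ if not. $\mathcal{Q}(\mathcal{I},\mathcal{T})$: verify $\mathcal{I}$ and set $\tilde{\mathcal{R}}=\mathcal{I}^+$. While $\mathcal{I}^-$ is non-empty: each hyperbox in $\mathcal{I}^-$ with largest side length $\le d_{\min}$ is discarded, every other one is replaced by two smaller hyperboxes in $\mathcal{P}_\cup(\mathcal{X}_\Delta)$ with disjoint interiors whose union is it; then verify the new list $\mathcal{I}^-$ against $\mathcal{T}$, obtaining new $\mathcal{I}^+,\mathcal{I}^-$, and set $\tilde{\mathcal{R}}\leftarrow\tilde{\mathcal{R}}\cup\mathcal{I}^+$. Return $\mathcal{Q}(\mathcal{I},\mathcal{T})=\tilde{\mathcal{R}}$. Main recursion: $\tilde{\mathcal{A}}_0(\mathcal{X}_s)=\mathcal{X}_s^\Delta$, $\tilde{\mathcal{A}}_{i+1}(\mathcal{X}_s)=\mathcal{Q}(\tilde{\mathcal{A}}_i(\mathcal{X}_s),\tilde{\mathcal{A}}_i(\mathcal{X}_s))$,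 stopping when $\tilde{\mathcal{A}}_{i+1}(\mathcal{X}_s)=\tilde{\mathcal{A}}_i(\mathcal{X}_s)$ and returning $\mathcal{C}=\tilde{\mathcal{A}}_i(\mathcal{X}_s)$. One iteration of the recursion is one evaluation of $\mathcal{Q}(\tilde{\mathcal{A}}_i(\mathcal{X}_s),\tilde{\mathcal{A}}_i(\mathcal{X}_s))$. *)

theory Defs
  imports "Jordan_Normal_Form.Matrix"
begin

section \<open>Hyperboxes\<close>

text \<open>A hyperbox \<open>[a,b]\<close> is stored as the pair of its corners. The order on vectors is
  element-wise and only relates vectors of equal dimension, so \<open>{a..b}\<close> is the closed box.\<close>

type_synonym hyperbox = "real vec \<times> real vec"

definition box_set :: "hyperbox \<Rightarrow> real vec set" where
  "box_set I = {fst I .. snd I}"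

definition is_hyperbox :: "nat \<Rightarrow> hyperbox \<Rightarrow> bool" where
  "is_hyperbox n I \<longleftrightarrow> fst I \<in> carrier_vec n \<and> snd I \<in> carrier_vec n \<and> fst I \<le> snd I"

definition open_box_set :: "nat \<Rightarrow> hyperbox \<Rightarrow> real vec set" where
  "open_box_set n I = {x \<in> carrier_vec n. \<forall>j<n. fst I $ j < x $ j \<and> x $ j < snd I $ j}"

definition is_open_hyperbox :: "nat \<Rightarrow> hyperbox \<Rightarrow> bool" where
  "is_open_hyperbox n I \<longleftrightarrow>
     fst I \<in> carrier_vec n \<and> snd I \<in> carrier_vec n \<and> (\<forall>j<n. fst I $ j < snd I $ j)"

text \<open>The type of vectors of arbitrary dimension carries no topology; this is the interior in
  \<open>\<real>\<^sup>n\<close> with respect to the maximum norm.\<close>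

definition vec_interior :: "nat \<Rightarrow> real vec set \<Rightarrow> real vec set" where
  "vec_interior n S = {x \<in> carrier_vec n. \<exists>e>0. \<forall>y\<in>carrier_vec n.
     (\<forall>j<n. \<bar>y $ j - x $ j\<bar> < e) \<longrightarrow> y \<in> S}"

definition list_set :: "hyperbox list \<Rightarrow> real vec set" where
  "list_set Is = (\<Union>I\<in>set Is. box_set I)"

definition Diag :: "real vec \<Rightarrow> real mat" where
  "Diag v = mat_diag (dim_vec v) (\<lambda>j. v $ j)"

definition binary_vec :: "nat \<Rightarrow> real vec \<Rightarrow> bool" where
  "binary_vec n v \<longleftrightarrow> v \<in> carrier_vec n \<and> (\<forall>j<n. v $ j \<in> {0, 1})"

abbreviation relu :: "real vec \<Rightarrow> real vec" where
  "relu v \<equiv> map_vec (max 0) v"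


section \<open>The neural network system\<close>

text \<open>Layers are numbered \<open>1, \<dots>, depth\<close>; \<open>width i\<close> is \<open>n\<^sub>i\<close> for \<open>0 \<le> i \<le> depth\<close>.\<close>

record nn_system =
  depth :: nat
  width :: "nat \<Rightarrow> nat"
  weight :: "nat \<Rightarrow> real mat"
  bias :: "nat \<Rightarrow> real vec"
  n_x :: nat
  n_u :: nat
  state_box :: hyperbox
  input_box :: hyperbox
  d_min :: real

fun activation :: "nn_system \<Rightarrow> real vec \<Rightarrow> real vec \<Rightarrow> nat \<Rightarrow> real vec" where
  "activation P x u 0 = x @\<^sub>v u"
| "activation P x u (Suc i) =
     relu (weight P (Suc i) *\<^sub>v activation P x u i + bias P (Suc i))"

definition network :: "nn_system \<Rightarrow> real vec \<Rightarrow> real vec \<Rightarrow> real vec" where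
  "network P x u =
     weight P (depth P) *\<^sub>v activation P x u (depth P - 1) + bias P (depth P)"

definition nn_system_wf :: "nn_system \<Rightarrow> bool" where
  "nn_system_wf P \<longleftrightarrow>
     2 \<le> depth P \<and> width P 0 = n_x P + n_u P \<and> width P (depth P) = n_x P \<and>
     (\<forall>i\<in>{1..depth P}. weight P i \<in> carrier_mat (width P i) (width P (i - 1)) \<and>
                       bias P i \<in> carrier_vec (width P i)) \<and>
     is_hyperbox (n_x P) (state_box P) \<and> is_hyperbox (n_u P) (input_box P) \<and>
     (\<forall>x\<in>box_set (state_box P). \<forall>u\<in>box_set (input_box P). network P x u \<in> box_set (state_box P)) \<and>
     0 < d_min P"


section \<open>Quantization\<close>

definition basis_box :: "nn_system \<Rightarrow> (nat \<Rightarrow> nat) \<Rightarrow> hyperbox" where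
  "basis_box P k =
     (let lo = fst (state_box P); hi = snd (state_box P); d = d_min P in
      (vec (n_x P) (\<lambda>j. lo $ j + real (k j) * d),
       vec (n_x P) (\<lambda>j. min (lo $ j + (real (k j) + 1) * d) (hi $ j))))"

definition basis_hyperboxes :: "nn_system \<Rightarrow> real vec set set" where
  "basis_hyperboxes P = {box_set (basis_box P k) | k. \<forall>j<n_x P.
     int (k j) \<le> \<lceil>(snd (state_box P) $ j - fst (state_box P) $ j) / d_min P\<rceil> - 1}"

definition unions_of_basis :: "nn_system \<Rightarrow> real vec set set" where
  "unions_of_basis P = {\<Union>\<B> | \<B>. \<B> \<subseteq> basis_hyperboxes P}"

text \<open>Index set of \<open>S\<close> relative to an enumeration \<open>X\<^sub>\<Delta> 1, \<dots>, X\<^sub>\<Delta> n\<^sub>\<Delta>\<close> of the basis hyperboxes.\<close>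

definition index_set :: "(nat \<Rightarrow> real vec set) \<Rightarrow> nat \<Rightarrow> real vec set \<Rightarrow> nat set" where
  "index_set X\<^sub>\<Delta> n\<^sub>\<Delta> S = (THE D. D \<subseteq> {1..n\<^sub>\<Delta>} \<and> S = (\<Union>j\<in>D. X\<^sub>\<Delta> j))"

definition quantized_hyperbox :: "nn_system \<Rightarrow> hyperbox \<Rightarrow> bool" where
  "quantized_hyperbox P I \<longleftrightarrow> is_hyperbox (n_x P) I \<and> box_set I \<in> unions_of_basis P"


section \<open>Interval reachability\<close>

definition lin_layer :: "hyperbox \<Rightarrow> real mat \<Rightarrow> real vec \<Rightarrow> hyperbox" where
  "lin_layer I W B =
     (let a = fst I; b = snd I in
      (vec (dim_row W) (\<lambda>j. (\<Sum>q\<in>{q. q < dim_col W \<and> W $$ (j,q) \<ge> 0}. W $$ (j,q) * a $ q)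
                          + (\<Sum>q\<in>{q. q < dim_col W \<and> W $$ (j,q) < 0}. W $$ (j,q) * b $ q)
                          + B $ j),
       vec (dim_row W) (\<lambda>j. (\<Sum>q\<in>{q. q < dim_col W \<and> W $$ (j,q) \<ge> 0}. W $$ (j,q) * b $ q)
                          + (\<Sum>q\<in>{q. q < dim_col W \<and> W $$ (j,q) < 0}. W $$ (j,q) * a $ q)
                          + B $ j)))"

fun post_activation_box :: "nn_system \<Rightarrow> hyperbox \<Rightarrow> hyperbox \<Rightarrow> nat \<Rightarrow> hyperbox" where
  "post_activation_box P X U 0 = (fst X @\<^sub>v fst U, snd X @\<^sub>v snd U)"
| "post_activation_box P X U (Suc i) =
     (let L = lin_layer (post_activation_box P X U i) (weight P (Suc i)) (bias P (Suc i))
      in (relu (fst L), relu (snd L)))"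

text \<open>The \<open>i\<close>-th pre-activation hyperbox, \<open>1 \<le> i \<le> depth\<close>.\<close>

definition reachable_hyperboxes :: "nn_system \<Rightarrow> hyperbox \<Rightarrow> hyperbox \<Rightarrow> nat \<Rightarrow> hyperbox" where
  "reachable_hyperboxes P X U i =
     lin_layer (post_activation_box P X U (i - 1)) (weight P i) (bias P i)"

definition F_bar :: "nn_system \<Rightarrow> hyperbox \<Rightarrow> hyperbox \<Rightarrow> hyperbox" where
  "F_bar P X U = reachable_hyperboxes P X U (depth P)"

abbreviation z_lo :: "nn_system \<Rightarrow> nat \<Rightarrow> real vec" where
  "z_lo P i \<equiv> fst (reachable_hyperboxes P (state_box P) (input_box P) i)"

abbreviation z_hi :: "nn_system \<Rightarrow> nat \<Rightarrow> real vec" where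
  "z_hi P i \<equiv> snd (reachable_hyperboxes P (state_box P) (input_box P) i)"


section \<open>The mixed-integer program\<close>

text \<open>Targets are given by the list of the open hyperboxes removed from the state box.\<close>

definition target :: "nn_system \<Rightarrow> hyperbox list \<Rightarrow> real vec set" where
  "target P obs = box_set (state_box P) - (\<Union>O\<^sub>m\<in>set obs. open_box_set (n_x P) O\<^sub>m)"

definition represents_target :: "nn_system \<Rightarrow> hyperbox list \<Rightarrow> real vec set \<Rightarrow> bool" where
  "represents_target P obs T \<longleftrightarrow>
     (\<forall>O\<^sub>m\<in>set obs. is_open_hyperbox (n_x P) O\<^sub>m) \<and> T = target P obs"

definition milc_input ::
  "nn_system \<Rightarrow> hyperbox \<Rightarrow> real vec \<Rightarrow> real vec \<Rightarrow> real vec \<Rightarrow> bool" where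
  "milc_input P I u a0 b0 \<longleftrightarrow>
     a0 = fst I @\<^sub>v u \<and> b0 = snd I @\<^sub>v u \<and> fst (input_box P) \<le> u \<and> u \<le> snd (input_box P)"

definition milc_affine ::
  "nn_system \<Rightarrow> nat \<Rightarrow> real vec \<Rightarrow> real vec \<Rightarrow> real vec \<Rightarrow> real vec \<Rightarrow> bool" where
  "milc_affine P i a_prev b_prev a_hat b_hat \<longleftrightarrow>
     (a_hat, b_hat) = lin_layer (a_prev, b_prev) (weight P i) (bias P i) \<and>
     z_lo P i \<le> a_hat \<and> a_hat \<le> b_hat \<and> b_hat \<le> z_hi P i"

definition milc_relu ::
  "nn_system \<Rightarrow> nat \<Rightarrow> real vec \<Rightarrow> real vec \<Rightarrow> real vec \<Rightarrow> real vec \<Rightarrow>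
   real vec \<Rightarrow> real vec \<Rightarrow> real vec \<Rightarrow> bool" where
  "milc_relu P i a_hat b_hat a b \<alpha> \<beta> \<gamma> \<longleftrightarrow>
     binary_vec (width P i) \<alpha> \<and> binary_vec (width P i) \<beta> \<and> binary_vec (width P i) \<gamma> \<and>
     (\<forall>j<width P i. \<alpha> $ j + \<beta> $ j + \<gamma> $ j = 1) \<and>
     a_hat \<le> a \<and> a \<le> Diag (z_hi P i) *\<^sub>v \<gamma> \<and>
     a \<le> a_hat - Diag (z_lo P i) *\<^sub>v (\<alpha> + \<beta>) \<and>
     b_hat \<le> b \<and> b \<le> b_hat - Diag (z_lo P i) *\<^sub>v \<alpha> \<and>
     b \<le> Diag (z_hi P i) *\<^sub>v (\<beta> + \<gamma>) \<and>
     0\<^sub>v (width P i) \<le> a \<and> a \<le> b"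

definition milc_avoid ::
  "nn_system \<Rightarrow> hyperbox \<Rightarrow> real vec \<Rightarrow> real vec \<Rightarrow> real vec \<Rightarrow> real vec \<Rightarrow> bool" where
  "milc_avoid P O\<^sub>m x_next_lo x_next_hi \<phi> \<psi> \<longleftrightarrow>
     (let o_lo = fst O\<^sub>m; o_hi = snd O\<^sub>m; lo = fst (state_box P); hi = snd (state_box P) in
      binary_vec (n_x P) \<phi> \<and> binary_vec (n_x P) \<psi> \<and>
      (\<forall>j<n_x P. \<phi> $ j + \<psi> $ j \<le> 1) \<and> (\<Sum>j<n_x P. \<phi> $ j + \<psi> $ j) \<ge> 1 \<and>
      x_next_hi \<le> hi + Diag (o_lo - hi) *\<^sub>v \<phi> \<and>
      o_lo - Diag (o_lo - lo) *\<^sub>v \<phi> \<le> x_next_hi \<and>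
      lo + Diag (o_hi - lo) *\<^sub>v \<psi> \<le> x_next_lo \<and>
      x_next_lo \<le> o_hi - Diag (o_hi - hi) *\<^sub>v \<psi>)"

text \<open>Existence of a solution of MILC-OP for the hyperbox \<open>I\<close> and the target \<open>target P obs\<close>.
  Values of the variable families outside the stated index ranges are irrelevant.\<close>

definition milc_solvable :: "nn_system \<Rightarrow> hyperbox list \<Rightarrow> hyperbox \<Rightarrow> bool" where
  "milc_solvable P obs I \<longleftrightarrow>
     (\<exists>u (a :: nat \<Rightarrow> real vec) b a_hat b_hat \<alpha> \<beta> \<gamma> x_next_lo x_next_hi \<phi> \<psi>.
        milc_input P I u (a 0) (b 0) \<and>
        (\<forall>i\<in>{1..depth P}. milc_affine P i (a (i - 1)) (b (i - 1)) (a_hat i) (b_hat i)) \<and>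
        (\<forall>i\<in>{1..depth P - 1}.
           milc_relu P i (a_hat i) (b_hat i) (a i) (b i) (\<alpha> i) (\<beta> i) (\<gamma> i)) \<and>
        x_next_lo = a_hat (depth P) \<and> x_next_hi = b_hat (depth P) \<and>
        (\<forall>m<length obs. milc_avoid P (obs ! m) x_next_lo x_next_hi (\<phi> m) (\<psi> m)))"


section \<open>The synthesis process\<close>

definition verified :: "nn_system \<Rightarrow> hyperbox list \<Rightarrow> hyperbox \<Rightarrow> bool" where
  "verified P obs I \<longleftrightarrow>
     box_set (F_bar P I (input_box P)) \<inter> target P obs \<noteq> {} \<and> milc_solvable P obs I"

abbreviation verify_pos :: "nn_system \<Rightarrow> hyperbox list \<Rightarrow> hyperbox list \<Rightarrow> hyperbox list" where
  "verify_pos P obs Is \<equiv> filter (verified P obs) Is"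

abbreviation verify_neg :: "nn_system \<Rightarrow> hyperbox list \<Rightarrow> hyperbox list \<Rightarrow> hyperbox list" where
  "verify_neg P obs Is \<equiv> filter (\<lambda>I. \<not> verified P obs I) Is"

definition refine_box :: "nn_system \<Rightarrow> hyperbox \<Rightarrow> hyperbox list \<Rightarrow> bool" where
  "refine_box P I Js \<longleftrightarrow>
     (if \<forall>j<n_x P. snd I $ j - fst I $ j \<le> d_min P then Js = []
      else (\<exists>J\<^sub>1 J\<^sub>2. Js = [J\<^sub>1, J\<^sub>2] \<and> quantized_hyperbox P J\<^sub>1 \<and> quantized_hyperbox P J\<^sub>2 \<and>
              box_set J\<^sub>1 \<subset> box_set I \<and> box_set J\<^sub>2 \<subset> box_set I \<and>
              vec_interior (n_x P) (box_set J\<^sub>1) \<inter> vec_interior (n_x P) (box_set J\<^sub>2) = {} \<and>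
              box_set J\<^sub>1 \<union> box_set J\<^sub>2 = box_set I))"

definition refine_list :: "nn_system \<Rightarrow> hyperbox list \<Rightarrow> hyperbox list \<Rightarrow> bool" where
  "refine_list P Is Js \<longleftrightarrow> (\<exists>Jss. list_all2 (refine_box P) Is Jss \<and> Js = concat Jss)"

text \<open>A state of the evaluation of \<open>\<Q>\<close> is the pair of the accumulated result and the current
  list \<open>\<I>\<^sup>-\<close>. How a hyperbox is split is left open, hence the transitions form a relation.\<close>

type_synonym Q_state = "hyperbox list \<times> hyperbox list"

definition Q_init :: "nn_system \<Rightarrow> hyperbox list \<Rightarrow> hyperbox list \<Rightarrow> Q_state" where
  "Q_init P obs Is = (verify_pos P obs Is, verify_neg P obs Is)"

inductive Q_step :: "nn_system \<Rightarrow> hyperbox list \<Rightarrow> Q_state \<Rightarrow> Q_state \<Rightarrow> bool"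
  for P obs where
  "\<lbrakk>Neg \<noteq> []; refine_list P Neg Js\<rbrakk> \<Longrightarrow>
     Q_step P obs (R, Neg) (R @ verify_pos P obs Js, verify_neg P obs Js)"

text \<open>\<open>Q_returns P Is T R\<close>: some evaluation of \<open>\<Q>(Is, T)\<close> returns \<open>R\<close>.\<close>

definition Q_returns ::
  "nn_system \<Rightarrow> hyperbox list \<Rightarrow> real vec set \<Rightarrow> hyperbox list \<Rightarrow> bool" where
  "Q_returns P Is T R \<longleftrightarrow>
     (\<exists>obs. represents_target P obs T \<and> (Q_step P obs)\<^sup>*\<^sup>* (Q_init P obs Is) (R, []))"

text \<open>Configurations of the whole process: \<open>Recursion i A\<close> holds \<open>A = \<A>\<^sub>i\<close> before the evaluation
  of \<open>\<Q>(\<A>\<^sub>i, \<A>\<^sub>i)\<close>, \<open>Evaluation i A obs s\<close> is that evaluation in progress, and \<open>Stopped N C\<close> has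
  returned \<open>C\<close> after \<open>N\<close> evaluations of \<open>\<Q>\<close>.\<close>

datatype config =
    Recursion nat "hyperbox list"
  | Evaluation nat "hyperbox list" "hyperbox list" Q_state
  | Stopped nat "hyperbox list"

inductive cis_step :: "nn_system \<Rightarrow> config \<Rightarrow> config \<Rightarrow> bool" for P where
  start_Q: "represents_target P obs (list_set A) \<Longrightarrow>
     cis_step P (Recursion i A) (Evaluation i A obs (Q_init P obs A))"
| loop_Q: "Q_step P obs s s' \<Longrightarrow>
     cis_step P (Evaluation i A obs s) (Evaluation i A obs s')"
| continue: "list_set R \<noteq> list_set A \<Longrightarrow>
     cis_step P (Evaluation i A obs (R, [])) (Recursion (Suc i) R)"
| stop: "list_set R = list_set A \<Longrightarrow>
     cis_step P (Evaluation i A obs (R, [])) (Stopped (Suc i) A)"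

end

theory Submission
  imports Defs
begin

text \<open>Every set occurring in the process is a union of basis hyperboxes, so the number of basis
  hyperboxes it contains strictly decreases when the set shrinks properly. Since each evaluation
  of \<open>\<Q>\<close> returns a subset of its argument, this bounds the number of iterations. Inside an
  evaluation of \<open>\<Q>\<close>, a split replaces a hyperbox by proper quantized subsets, so the largest
  number of basis hyperboxes contained in a member of \<open>\<I>\<^sup>-\<close> strictly decreases; the outcome of the
  mixed-integer programs is irrelevant. The process never gets stuck: the complement of finitely
  many closed boxes is a finite union of open ones, and a quantized hyperbox with a side longer
  than \<open>d_min\<close> can be cut along a grid hyperplane.\<close>

section \<open>Coordinates of boxes and interior points\<close>

lemma box_set_iff:
  assumes "fst I \<in> carrier_vec n" "snd I \<in> carrier_vec n"
  shows "x \<in> box_set I \<longleftrightarrow> x \<in> carrier_vec n \<and> (\<forall>j<n. fst I $ j \<le> x $ j \<and> x $ j \<le> snd I $ j)"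
proof -
  have "dim_vec (fst I) = n" "dim_vec (snd I) = n"
    using assms by auto
  then show ?thesis
    unfolding box_set_def atLeastAtMost_iff less_eq_vec_def carrier_vec_def mem_Collect_eq
    by (metis (no_types))
qed

lemma corners_mem: "is_hyperbox m I \<Longrightarrow> fst I \<in> box_set I \<and> snd I \<in> box_set I"
  by (auto simp: box_set_def is_hyperbox_def less_eq_vec_def)

text \<open>Moving all coordinates by half the radius stays in the ball, so an interior point is
  extremal in no coordinate. This separates the interiors of two boxes that share a face.\<close>

lemma vec_interior_coord_less:
  assumes "x \<in> vec_interior l S" "j < l"
  shows "\<exists>y\<in>S. x $ j < y $ j" "\<exists>y\<in>S. y $ j < x $ j"
proof -
  obtain e where e: "e > 0" "x \<in> carrier_vec l"
    "\<And>y. y \<in> carrier_vec l \<Longrightarrow> (\<forall>i<l. \<bar>y $ i - x $ i\<bar> < e) \<Longrightarrow> y \<in> S"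
    using assms by (auto simp: vec_interior_def)
  have "vec l (\<lambda>i. x $ i + e / 2) \<in> S" "vec l (\<lambda>i. x $ i - e / 2) \<in> S"
    using e(1) by (intro e(3); simp)+
  then show "\<exists>y\<in>S. x $ j < y $ j" "\<exists>y\<in>S. y $ j < x $ j"
    using assms(2) e(1) by (force intro: bexI[rotated])+
qed

subsection \<open>Complements of finite unions of boxes\<close>

text \<open>The pieces of the open box \<open>G\<close> beyond each face of \<open>I\<close>; the filter drops empty pieces,
  which are not open hyperboxes.\<close>

definition face_boxes :: "nat \<Rightarrow> hyperbox \<Rightarrow> hyperbox \<Rightarrow> hyperbox list" where
  "face_boxes n G I = filter (is_open_hyperbox n)
     (map (\<lambda>j. (fst G, vec n (\<lambda>i. if i = j then min (fst I $ j) (snd G $ j) else snd G $ i))) [0..<n] @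
      map (\<lambda>j. (vec n (\<lambda>i. if i = j then max (snd I $ j) (fst G $ j) else fst G $ i), snd G)) [0..<n])"

text \<open>Taking \<open>min\<close> or \<open>max\<close> with the old corner keeps the piece
  inside the box \<open>(g, h)\<close> wherever the face lies. For \<open>j \<ge> n\<close> no entry
  changes, hence the guard.\<close>

lemma mem_open_box_face:
  "x \<in> open_box_set n (g, vec n (\<lambda>i. if i = j then min a (h $ j) else h $ i)) \<longleftrightarrow>
     x \<in> open_box_set n (g, h) \<and> (j < n \<longrightarrow> x $ j < a)"
  "x \<in> open_box_set n (vec n (\<lambda>i. if i = j then max a (g $ j) else g $ i), h) \<longleftrightarrow>
     x \<in> open_box_set n (g, h) \<and> (j < n \<longrightarrow> a < x $ j)"
  unfolding open_box_set_def by auto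

lemma open_box_set_nonempty_imp:
  assumes "x \<in> open_box_set n G" "fst G \<in> carrier_vec n" "snd G \<in> carrier_vec n"
  shows "is_open_hyperbox n G"
  using assms unfolding open_box_set_def is_open_hyperbox_def by force

text \<open>A point of \<open>G\<close> avoids the closed box \<open>I\<close> exactly when it
  violates one of the \<open>2 * n\<close> coordinate inequalities. Each violation is strict and so
  describes an open piece.\<close>

lemma face_boxes_union:
  assumes "is_hyperbox n I" "is_open_hyperbox n G"
  shows "(\<Union>H\<in>set (face_boxes n G I). open_box_set n H) = open_box_set n G - box_set I"
proof -
  have c: "fst G \<in> carrier_vec n" "snd G \<in> carrier_vec n"
    using assms by (auto simp: is_open_hyperbox_def)
  have *: "(\<exists>H\<in>set (face_boxes n G I). x \<in> open_box_set n H) \<longleftrightarrow>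
     (\<exists>j<n. x \<in> open_box_set n G \<and> (x $ j < fst I $ j \<or> snd I $ j < x $ j))" (is "?l \<longleftrightarrow> ?r") for x
  proof
    assume ?l
    then show ?r
      unfolding face_boxes_def by (auto simp: mem_open_box_face)
  next
    assume ?r
    then obtain j where j: "j < n" and xG: "x \<in> open_box_set n G"
      and "x $ j < fst I $ j \<or> snd I $ j < x $ j" by blast
    from this(3) show ?l
    proof
      assume "x $ j < fst I $ j"
      then have m: "x \<in> open_box_set n
          (fst G, vec n (\<lambda>i. if i = j then min (fst I $ j) (snd G $ j) else snd G $ i))"
        using xG by (simp add: mem_open_box_face)
      then show ?l
        using j c open_box_set_nonempty_imp[OF m] unfolding face_boxes_def
        by (intro bexI[where P = "\<lambda>H. x \<in> open_box_set n H", OF m]) auto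
    next
      assume "snd I $ j < x $ j"
      then have m: "x \<in> open_box_set n
          (vec n (\<lambda>i. if i = j then max (snd I $ j) (fst G $ j) else fst G $ i), snd G)"
        using xG by (simp add: mem_open_box_face)
      then show ?l
        using j c open_box_set_nonempty_imp[OF m] unfolding face_boxes_def
        by (intro bexI[where P = "\<lambda>H. x \<in> open_box_set n H", OF m]) auto
    qed
  qed
  have b: "x \<in> box_set I \<longleftrightarrow> (\<forall>j<n. fst I $ j \<le> x $ j \<and> x $ j \<le> snd I $ j)"
    if "x \<in> open_box_set n G" for x
    using that assms(1) by (subst box_set_iff[of _ n]) (auto simp: is_hyperbox_def open_box_set_def)
  show ?thesis
    using * b by (auto simp: not_le) (meson not_le)+
qed

text \<open>Boxes are removed one at a time: each open piece left so far is replaced by its face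
  boxes.\<close>

lemma open_boxes_diff_list_set:
  assumes "\<forall>I\<in>set Is. is_hyperbox n I" "is_open_hyperbox n G"
  shows "\<exists>Hs. (\<forall>H\<in>set Hs. is_open_hyperbox n H) \<and>
    (\<Union>H\<in>set Hs. open_box_set n H) = open_box_set n G - list_set Is"
  using assms(1)
proof (induction Is)
  case Nil
  show ?case
    by (rule exI[of _ "[G]"]) (use assms in \<open>auto simp: list_set_def\<close>)
next
  case (Cons I Is)
  then obtain Hs where Hs: "\<forall>H\<in>set Hs. is_open_hyperbox n H"
    "(\<Union>H\<in>set Hs. open_box_set n H) = open_box_set n G - list_set Is"
    by auto
  let ?Ks = "concat (map (\<lambda>H. face_boxes n H I) Hs)"
  have "\<forall>H\<in>set ?Ks. is_open_hyperbox n H"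
    by (auto simp: face_boxes_def)
  moreover have "(\<Union>K\<in>set ?Ks. open_box_set n K) =
      (\<Union>H\<in>set Hs. \<Union>K\<in>set (face_boxes n H I). open_box_set n K)"
    by auto
  moreover have "\<dots> = (\<Union>H\<in>set Hs. open_box_set n H - box_set I)"
    using Hs(1) Cons.prems by (intro SUP_cong refl face_boxes_union) auto
  moreover have "\<dots> = open_box_set n G - list_set (I # Is)"
    using Hs(2) by (auto simp: list_set_def)
  ultimately show ?case
    by metis
qed

lemma represents_target_exists:
  assumes "is_hyperbox (n_x P) (state_box P)" "\<forall>I\<in>set Is. is_hyperbox (n_x P) I"
    and "list_set Is \<subseteq> box_set (state_box P)"
  shows "\<exists>obs. represents_target P obs (list_set Is)"
proof -
  let ?n = "n_x P"
  \<comment> \<open>Widening by 1 puts even the boundary of the state box inside an open box. Pieces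
    may stick out, since \<open>target\<close> only subtracts them from the state box.\<close>
  let ?G = "(vec ?n (\<lambda>j. fst (state_box P) $ j - 1), vec ?n (\<lambda>j. snd (state_box P) $ j + 1))"
  have le: "fst (state_box P) $ j \<le> snd (state_box P) $ j" if "j < ?n" for j
    using assms(1) that by (auto simp: is_hyperbox_def less_eq_vec_def)
  have "is_open_hyperbox ?n ?G"
    using le by (fastforce simp: is_open_hyperbox_def)
  from open_boxes_diff_list_set[OF assms(2) this] obtain Hs where
    "\<forall>H\<in>set Hs. is_open_hyperbox ?n H"
    "(\<Union>H\<in>set Hs. open_box_set ?n H) = open_box_set ?n ?G - list_set Is" by auto
  moreover have "box_set (state_box P) \<subseteq> open_box_set ?n ?G"
    using assms(1) by (fastforce simp: box_set_iff[of _ ?n] is_hyperbox_def open_box_set_def)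
  ultimately have "represents_target P Hs (list_set Is)"
    using assms(3) unfolding represents_target_def target_def by auto
  then show ?thesis ..
qed

subsection \<open>The grid\<close>

text \<open>The block of cells with indices from \<open>k\<close> to \<open>m\<close>, both
  inclusive, hence the \<open>+ 1\<close>; \<open>k = m\<close> gives a single cell.\<close>

definition grid_box :: "nn_system \<Rightarrow> (nat \<Rightarrow> nat) \<Rightarrow> (nat \<Rightarrow> nat) \<Rightarrow> hyperbox" where
  "grid_box P k m =
     (vec (n_x P) (\<lambda>j. fst (state_box P) $ j + real (k j) * d_min P),
      vec (n_x P) (\<lambda>j. min (fst (state_box P) $ j + (real (m j) + 1) * d_min P) (snd (state_box P) $ j)))"

text \<open>As \<open>0 < d_min P\<close>, this is the range \<open>k j \<le> \<lceil>(hi j - lo j) / d_min P\<rceil> - 1\<close>.\<close>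

definition grid_indices :: "nn_system \<Rightarrow> (nat \<Rightarrow> nat) \<Rightarrow> bool" where
  "grid_indices P k \<longleftrightarrow>
     (\<forall>j<n_x P. fst (state_box P) $ j + real (k j) * d_min P < snd (state_box P) $ j)"

lemma basis_box_eq: "basis_box P k = grid_box P k k"
  by (simp add: basis_box_def grid_box_def Let_def)

lemma mem_grid_box:
  "x \<in> box_set (grid_box P k m) \<longleftrightarrow> x \<in> carrier_vec (n_x P) \<and>
     (\<forall>j<n_x P. fst (state_box P) $ j + real (k j) * d_min P \<le> x $ j \<and>
        x $ j \<le> fst (state_box P) $ j + (real (m j) + 1) * d_min P \<and> x $ j \<le> snd (state_box P) $ j)"
  by (subst box_set_iff[of _ "n_x P"]) (auto simp: grid_box_def)

locale quantized_system =
  fixes P :: nn_system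
  assumes wf: "nn_system_wf P"
begin

abbreviation "lo j \<equiv> fst (state_box P) $ j"
abbreviation "hi j \<equiv> snd (state_box P) $ j"
abbreviation "d \<equiv> d_min P"
abbreviation "n \<equiv> n_x P"

lemma d_pos: "0 < d"
  and state_box_hyperbox: "is_hyperbox n (state_box P)"
  using wf by (auto simp: nn_system_wf_def)

text \<open>An integer is at most the ceiling minus one exactly when it is strictly below the real
  quotient. So all cells have positive side lengths.\<close>

lemma basis_hyperboxes_eq:
  "basis_hyperboxes P = {box_set (grid_box P k k) | k. grid_indices P k}"
proof -
  have "int (k j) \<le> \<lceil>(hi j - lo j) / d\<rceil> - 1 \<longleftrightarrow> lo j + real (k j) * d < hi j" for k j
  proof -
    have "int (k j) \<le> \<lceil>(hi j - lo j) / d\<rceil> - 1 \<longleftrightarrow> int (k j) < \<lceil>(hi j - lo j) / d\<rceil>"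
      by linarith
    also have "\<dots> \<longleftrightarrow> real (k j) < (hi j - lo j) / d"
      by (simp add: less_ceiling_iff)
    also have "\<dots> \<longleftrightarrow> lo j + real (k j) * d < hi j"
      using d_pos by (simp add: field_simps)
    finally show ?thesis .
  qed
  then show ?thesis
    by (simp add: basis_hyperboxes_def basis_box_eq grid_indices_def)
qed

lemma grid_box_hyperbox:
  assumes "grid_indices P m" "\<forall>j<n. k j \<le> m j"
  shows "is_hyperbox n (grid_box P k m)"
proof -
  have "lo j + real (k j) * d \<le> lo j + (real (m j) + 1) * d"
    "lo j + real (k j) * d \<le> hi j" if "j < n" for j
  proof -
    have "real (k j) * d \<le> real (m j) * d"
      using assms(2) that d_pos by auto
    moreover have "lo j + real (m j) * d < hi j"
      using assms(1) that by (simp add: grid_indices_def)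
    ultimately show "lo j + real (k j) * d \<le> lo j + (real (m j) + 1) * d" "lo j + real (k j) * d \<le> hi j"
      using d_pos unfolding distrib_right by linarith+
  qed
  then show ?thesis
    by (auto simp: is_hyperbox_def grid_box_def less_eq_vec_def)
qed

lemma grid_box_quantized:
  assumes "grid_indices P m" "\<forall>j<n. k j \<le> m j"
  shows "quantized_hyperbox P (grid_box P k m)"
proof -
  let ?B = "{box_set (grid_box P q q) | q. \<forall>j<n. k j \<le> q j \<and> q j \<le> m j}"
  have mono: "real p * d \<le> real q * d" if "p \<le> q" for p q
    using that d_pos by simp
  have sub: "?B \<subseteq> basis_hyperboxes P"
    using assms(1) mono unfolding basis_hyperboxes_eq grid_indices_def
    by (smt (verit, best) Collect_mono_iff)
  have "box_set (grid_box P k m) = \<Union>?B"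
  proof (intro equalityI subsetI)
    fix x assume x: "x \<in> box_set (grid_box P k m)"
    \<comment> \<open>A cell index is chosen in each coordinate: \<open>m j\<close> from the lower
      end of the last cell onwards, otherwise a floor. The case split is needed because on the upper
      face the floor could be \<open>m j + 1\<close>.\<close>
    have "\<exists>q. k j \<le> q \<and> q \<le> m j \<and> lo j + real q * d \<le> x $ j \<and> x $ j \<le> lo j + (real q + 1) * d"
      if "j < n" for j
    proof (cases "lo j + real (m j) * d \<le> x $ j")
      case True
      then show ?thesis
        using that x assms(2) by (intro exI[of _ "m j"]) (auto simp: mem_grid_box)
    next
      case False
      define y where "y = (x $ j - lo j) / d"
      have y: "real (k j) \<le> y" "y < real (m j)" "x $ j = lo j + y * d"
        using False that x d_pos by (auto simp: mem_grid_box y_def field_simps)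
      define q where "q = nat \<lfloor>y\<rfloor>"
      have q: "real q \<le> y" "y \<le> real q + 1" "k j \<le> q" "q \<le> m j"
        using y(1,2) unfolding q_def by linarith+
      have "real q * d \<le> y * d" "y * d \<le> (real q + 1) * d"
        using q d_pos by (auto intro!: mult_right_mono)
      then show ?thesis
        using q y(3) by auto
    qed
    then obtain q where q: "\<And>j. j < n \<Longrightarrow> k j \<le> q j \<and> q j \<le> m j \<and>
        lo j + real (q j) * d \<le> x $ j \<and> x $ j \<le> lo j + (real (q j) + 1) * d"
      by metis
    then have "x \<in> box_set (grid_box P q q)"
      using x by (auto simp: mem_grid_box)
    then show "x \<in> \<Union>?B"
      using q by blast
  next
    fix x assume "x \<in> \<Union>?B"
    then obtain q where q: "\<forall>j<n. k j \<le> q j \<and> q j \<le> m j" and x: "x \<in> box_set (grid_box P q q)"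
      by blast
    have "real (k j) * d \<le> real (q j) * d" "(real (q j) + 1) * d \<le> (real (m j) + 1) * d"
      if "j < n" for j
      using q that d_pos by auto
    then show "x \<in> box_set (grid_box P k m)"
      using x unfolding mem_grid_box by (meson add_left_mono order_trans)
  qed
  then have "box_set (grid_box P k m) \<in> unions_of_basis P"
    using sub by (auto simp: unions_of_basis_def)
  then show ?thesis
    using grid_box_hyperbox[OF assms] by (simp add: quantized_hyperbox_def)
qed

lemma basis_hyperboxE:
  assumes "B \<in> basis_hyperboxes P"
  obtains q where "grid_indices P q" "B = box_set (grid_box P q q)"
    "is_hyperbox n (grid_box P q q)"
  using assms grid_box_hyperbox unfolding basis_hyperboxes_eq by blast

text \<open>Converse of \<open>grid_box_quantized\<close>: \<open>k\<close> and \<open>m\<close>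
  index cells inside \<open>I\<close> that contain its lower and its upper corner.\<close>

lemma quantized_gridE:
  assumes "quantized_hyperbox P I"
  obtains k m where "grid_indices P m" "\<forall>j<n. k j \<le> m j" "I = grid_box P k m"
proof -
  have I: "is_hyperbox n I" and Ic: "fst I \<in> carrier_vec n" "snd I \<in> carrier_vec n"
    using assms by (auto simp: quantized_hyperbox_def is_hyperbox_def)
  obtain \<B> where \<B>: "\<B> \<subseteq> basis_hyperboxes P" "box_set I = \<Union>\<B>"
    using assms by (auto simp: quantized_hyperbox_def unions_of_basis_def)
  have cell: "\<exists>q. grid_indices P q \<and> x \<in> box_set (grid_box P q q) \<and>
      box_set (grid_box P q q) \<subseteq> box_set I \<and> is_hyperbox n (grid_box P q q)"
    if x: "x \<in> box_set I" for x
  proof -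
    obtain B where B: "B \<in> \<B>" "x \<in> B" using x \<B>(2) by blast
    then have "B \<in> basis_hyperboxes P" "B \<subseteq> box_set I" using \<B> by blast+
    then show ?thesis using B(2) by (metis basis_hyperboxE)
  qed
  obtain k where k: "grid_indices P k" "fst I \<in> box_set (grid_box P k k)"
    "box_set (grid_box P k k) \<subseteq> box_set I" "is_hyperbox n (grid_box P k k)"
    using cell corners_mem[OF I] by metis
  obtain m where m: "grid_indices P m" "snd I \<in> box_set (grid_box P m m)"
    "box_set (grid_box P m m) \<subseteq> box_set I" "is_hyperbox n (grid_box P m m)"
    using cell corners_mem[OF I] by metis
  \<comment> \<open>One inequality holds because the cell lies in \<open>I\<close>, the other
    because the corner lies in the cell.\<close>
  have fI: "fst I $ j = lo j + real (k j) * d" if "j < n" for j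
  proof (rule antisym)
    show "fst I $ j \<le> lo j + real (k j) * d"
      using that k(3) corners_mem[OF k(4)] box_set_iff[OF Ic] by (force simp: grid_box_def)
    show "lo j + real (k j) * d \<le> fst I $ j"
      using that k(2) by (simp add: mem_grid_box)
  qed
  have sI: "snd I $ j = min (lo j + (real (m j) + 1) * d) (hi j)" if "j < n" for j
  proof (rule antisym)
    show "min (lo j + (real (m j) + 1) * d) (hi j) \<le> snd I $ j"
      using that m(3) corners_mem[OF m(4)] box_set_iff[OF Ic] by (force simp: grid_box_def)
    show "snd I $ j \<le> min (lo j + (real (m j) + 1) * d) (hi j)"
      using that m(2) by (simp add: mem_grid_box)
  qed
  \<comment> \<open>Cell \<open>k\<close> has positive width and its upper corner lies in
    \<open>I\<close>, so it starts strictly before cell \<open>m\<close> ends.\<close>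
  have "k j \<le> m j" if j: "j < n" for j
  proof -
    have "snd (grid_box P k k) \<in> box_set I"
      using k(3) corners_mem[OF k(4)] by blast
    then have "min (lo j + (real (k j) + 1) * d) (hi j) \<le> snd I $ j"
      using j box_set_iff[OF Ic] by (auto simp: grid_box_def)
    moreover have "lo j + real (k j) * d < min (lo j + (real (k j) + 1) * d) (hi j)"
      using k(1) j d_pos by (auto simp: grid_indices_def algebra_simps)
    ultimately have "real (k j) * d < (real (m j) + 1) * d"
      using sI[OF j] by linarith
    then have "real (k j) < real (m j) + 1"
      using d_pos by simp
    then show ?thesis by linarith
  qed
  moreover have "I = grid_box P k m"
    using Ic fI sI by (auto simp: grid_box_def prod_eq_iff)
  ultimately show thesis
    using that m(1) by blast
qed

section \<open>Splitting quantized boxes\<close>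

lemma quantized_subset_state_box:
  assumes "quantized_hyperbox P I"
  shows "box_set I \<subseteq> box_set (state_box P)"
proof -
  obtain k m where I: "I = grid_box P k m" using assms by (blast elim: quantized_gridE)
  have "0 \<le> real q * d" for q using d_pos by simp
  then show ?thesis
    using state_box_hyperbox unfolding I
    by (smt (verit) box_set_iff is_hyperbox_def mem_grid_box subsetI)
qed

text \<open>A side longer than \<open>d\<close> spans at least two layers of cells, so the box can
  be cut at the first grid hyperplane beyond its lower face.\<close>

lemma refine_box_exists:
  assumes "quantized_hyperbox P I"
  shows "\<exists>Js. refine_box P I Js"
proof (cases "\<forall>j<n. snd I $ j - fst I $ j \<le> d")
  case True
  then show ?thesis by (auto simp: refine_box_def)
next
  case False
  then obtain j where j: "j < n" "d < snd I $ j - fst I $ j" by (auto simp: not_le)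
  obtain k m where km: "grid_indices P m" "\<forall>j<n. k j \<le> m j" and I: "I = grid_box P k m"
    using assms by (blast elim: quantized_gridE)
  have "real (k j) * d + d < (real (m j) + 1) * d"
    using j by (auto simp: I grid_box_def)
  then have "real (k j) * d < real (m j) * d" by (simp add: distrib_right)
  then have less: "k j < m j" using d_pos by simp
  \<comment> \<open>\<open>J1\<close> is the lowest layer in direction \<open>j\<close>,
    \<open>J2\<close> the remaining layers; they meet at \<open>?c\<close>.\<close>
  define J1 where "J1 = grid_box P k (m(j := k j))"
  define J2 where "J2 = grid_box P (k(j := Suc (k j))) m"
  let ?c = "lo j + (real (k j) + 1) * d"
  have "(real (k j) + 1) * d \<le> real (m j) * d"
    using less d_pos by (intro mult_right_mono) linarith+
  moreover have "lo j + real (m j) * d < hi j"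
    using km(1) j(1) by (auto simp: grid_indices_def)
  ultimately have c: "?c < hi j" "?c < lo j + (real (m j) + 1) * d" "lo j + real (k j) * d < ?c"
    using d_pos unfolding distrib_right by linarith+
  have gi: "grid_indices P (m(j := k j))"
    using km(1) c(1,3) by (auto simp: grid_indices_def intro: less_trans)
  have q: "quantized_hyperbox P J1" "quantized_hyperbox P J2"
    unfolding J1_def J2_def using km less gi by (auto intro!: grid_box_quantized)
  have J1: "x \<in> box_set J1 \<longleftrightarrow> x \<in> box_set I \<and> x $ j \<le> ?c" for x
    unfolding J1_def I mem_grid_box using j(1) c by (smt (verit) fun_upd_apply)
  have J2: "x \<in> box_set J2 \<longleftrightarrow> x \<in> box_set I \<and> ?c \<le> x $ j" for x
    unfolding J2_def I mem_grid_box using j(1) c by (smt (verit) fun_upd_apply of_nat_Suc)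
  have hI: "is_hyperbox n I" using assms by (simp add: quantized_hyperbox_def)
  \<comment> \<open>Each half misses one corner of \<open>I\<close>, which makes both inclusions
    proper.\<close>
  have "fst I \<notin> box_set J2" "snd I \<notin> box_set J1"
    using j(1) c by (auto simp: J1 J2 I grid_box_def)
  then have "box_set J1 \<subset> box_set I" "box_set J2 \<subset> box_set I"
    using J1 J2 corners_mem[OF hI] by blast+
  moreover have "box_set J1 \<union> box_set J2 = box_set I"
    using J1 J2 linear[of _ ?c] by blast
  moreover have "vec_interior n (box_set J1) \<inter> vec_interior n (box_set J2) = {}"
  proof -
    have False if x: "x \<in> vec_interior n (box_set J1)" "x \<in> vec_interior n (box_set J2)" for x
      using vec_interior_coord_less(1)[OF x(1) j(1)] vec_interior_coord_less(2)[OF x(2) j(1)] J1 J2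
      by force
    then show ?thesis by blast
  qed
  ultimately have "refine_box P I [J1, J2]"
    unfolding refine_box_def if_not_P[OF False] using q by blast
  then show ?thesis ..
qed

lemma refine_list_exists:
  assumes "\<forall>I\<in>set Is. quantized_hyperbox P I"
  shows "\<exists>Js. refine_list P Is Js"
proof -
  have "\<exists>Jss. list_all2 (refine_box P) Is Jss"
    using assms
  proof (induction Is)
    case (Cons I Is)
    then show ?case
      using refine_box_exists[of I] by (auto simp: list_all2_Cons1)
  qed auto
  then show ?thesis by (auto simp: refine_list_def)
qed

lemma refine_list_mem:
  assumes "refine_list P Is Js" "J \<in> set Js"
  shows "quantized_hyperbox P J \<and> (\<exists>I\<in>set Is. box_set J \<subset> box_set I)"
proof -
  obtain Jss where Jss: "list_all2 (refine_box P) Is Jss" "Js = concat Jss"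
    using assms(1) by (auto simp: refine_list_def)
  then obtain i where "i < length Jss" "J \<in> set (Jss ! i)"
    using assms(2) by (metis UN_E in_set_conv_nth set_concat)
  with Jss(1) show ?thesis
    by (auto simp: list_all2_conv_all_nth refine_box_def split: if_splits
        intro!: bexI[of _ "Is ! i"]; force)
qed

subsection \<open>Counting basis hyperboxes\<close>

text \<open>An enumeration-free form of the size of the index set; \<open>card_index_set\<close>
  shows agreement on unions of basis hyperboxes.\<close>

definition count :: "real vec set \<Rightarrow> nat" where
  "count S = card {B \<in> basis_hyperboxes P. B \<subseteq> S}"

lemma finite_basis_hyperboxes: "finite (basis_hyperboxes P)"
proof -
  define M where "M = Max (insert 0 ((\<lambda>j. nat \<lceil>(hi j - lo j) / d\<rceil>) ` {..<n}))"
  have "basis_hyperboxes P \<subseteq> (\<lambda>k. box_set (basis_box P k)) ` PiE {..<n} (\<lambda>_. {..M})"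
  proof
    fix B assume "B \<in> basis_hyperboxes P"
    then obtain k where k: "B = box_set (basis_box P k)"
      "\<forall>j<n. int (k j) \<le> \<lceil>(hi j - lo j) / d\<rceil> - 1"
      by (auto simp: basis_hyperboxes_def)
    have "k j \<le> M" if "j < n" for j
    proof -
      have "k j \<le> nat \<lceil>(hi j - lo j) / d\<rceil>" using k(2) that by fastforce
      also have "\<dots> \<le> M" unfolding M_def using that by (intro Max_ge) auto
      finally show ?thesis .
    qed
    \<comment> \<open>Values of \<open>k\<close> beyond the dimension do not affect the cell, so
      finitely many index functions suffice.\<close>
    then have "restrict k {..<n} \<in> PiE {..<n} (\<lambda>_. {..M})" by auto
    moreover have "basis_box P (restrict k {..<n}) = basis_box P k"
      by (auto simp: basis_box_def Let_def)
    ultimately show "B \<in> (\<lambda>k. box_set (basis_box P k)) ` PiE {..<n} (\<lambda>_. {..M})"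
      using k(1) by (metis image_eqI)
  qed
  then show ?thesis
    by (rule finite_subset) (auto intro!: finite_imageI finite_PiE)
qed

text \<open>A point of \<open>T\<close> outside \<open>S\<close> lies in a cell contained in
  \<open>T\<close> but not in \<open>S\<close>; \<open>S\<close> may be any set.\<close>

lemma count_strict_mono:
  assumes "S \<subset> T" "T \<in> unions_of_basis P"
  shows "count S < count T"
proof -
  obtain \<B> where \<B>: "\<B> \<subseteq> basis_hyperboxes P" "T = \<Union>\<B>"
    using assms(2) by (auto simp: unions_of_basis_def)
  then obtain B where "B \<in> \<B>" "\<not> B \<subseteq> S" using assms(1) by blast
  then show ?thesis
    unfolding count_def using \<B> assms(1) finite_basis_hyperboxes
    by (intro psubset_card_mono) auto
qed

lemma count_quantized_pos:
  assumes "quantized_hyperbox P I"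
  shows "0 < count (box_set I)"
proof -
  have "{} \<subset> box_set I" "box_set I \<in> unions_of_basis P"
    using assms corners_mem[of n I] by (auto simp: quantized_hyperbox_def)
  from count_strict_mono[OF this] show ?thesis by linarith
qed

lemma list_set_in_unions:
  assumes "\<forall>I\<in>set Is. quantized_hyperbox P I"
  shows "list_set Is \<in> unions_of_basis P"
proof -
  have "\<exists>\<B>\<subseteq>basis_hyperboxes P. box_set I = \<Union>\<B>" if "I \<in> set Is" for I
    using bspec[OF assms that] unfolding quantized_hyperbox_def unions_of_basis_def by blast
  then obtain f where "\<And>I. I \<in> set Is \<Longrightarrow> f I \<subseteq> basis_hyperboxes P \<and> box_set I = \<Union>(f I)" by metis
  then have "list_set Is = \<Union>(\<Union>(f ` set Is))" "\<Union>(f ` set Is) \<subseteq> basis_hyperboxes P"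
    by (auto simp: list_set_def)
  then show ?thesis by (auto simp: unions_of_basis_def)
qed

text \<open>Distinct cells overlap at most along boundaries, so none is covered by the others. This
  makes index sets unique.\<close>

lemma basis_hyperbox_subset_Union:
  assumes "B \<in> basis_hyperboxes P" "\<B> \<subseteq> basis_hyperboxes P" "B \<subseteq> \<Union>\<B>"
  shows "B \<in> \<B>"
proof -
  obtain q where q: "grid_indices P q" "B = box_set (grid_box P q q)"
    using assms(1) by (rule basis_hyperboxE)
  \<comment> \<open>the centre \<open>x\<close> of \<open>B\<close> lies in no other basis hyperbox\<close>
  define u where "u j = min (lo j + (real (q j) + 1) * d) (hi j)" for j
  define x where "x = vec n (\<lambda>j. (lo j + real (q j) * d + u j) / 2)"
  have x: "lo j + real (q j) * d < x $ j" "x $ j < lo j + (real (q j) + 1) * d" "x $ j < hi j"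
    if "j < n" for j
    using q(1) that d_pos by (auto simp: x_def u_def grid_indices_def min_def field_simps)
  have "x \<in> B"
    using x by (auto simp: q(2) mem_grid_box x_def intro: less_imp_le)
  then obtain B' where B': "B' \<in> \<B>" "x \<in> B'" using assms(3) by blast
  obtain r where r: "B' = box_set (grid_box P r r)"
    using B'(1) assms(2) by (auto elim: basis_hyperboxE)
  have "q j = r j" if "j < n" for j
  proof -
    have "lo j + real (r j) * d \<le> x $ j" "x $ j \<le> lo j + (real (r j) + 1) * d"
      using B'(2) that by (auto simp: r mem_grid_box)
    then have "real (r j) * d < (real (q j) + 1) * d" "real (q j) * d < (real (r j) + 1) * d"
      using x[OF that] by linarith+
    then have "real (r j) < real (q j) + 1" "real (q j) < real (r j) + 1"
      using d_pos by simp_all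
    then show ?thesis by linarith
  qed
  then have "grid_box P q q = grid_box P r r" by (auto simp: grid_box_def)
  then show ?thesis using B'(1) r q(2) by simp
qed

lemma card_index_set:
  assumes "bij_betw X {1..N} (basis_hyperboxes P)" "S \<in> unions_of_basis P"
  shows "card (index_set X N S) = count S"
proof -
  \<comment> \<open>\<open>D\<close> is the largest candidate for the index set; by
    \<open>basis_hyperbox_subset_Union\<close> no smaller one covers \<open>S\<close>.\<close>
  define D where "D = {j \<in> {1..N}. X j \<subseteq> S}"
  have im: "X ` {1..N} = basis_hyperboxes P" and inj: "inj_on X {1..N}"
    using assms(1) by (auto simp: bij_betw_def)
  obtain \<B> where \<B>: "\<B> \<subseteq> basis_hyperboxes P" "S = \<Union>\<B>"
    using assms(2) by (auto simp: unions_of_basis_def)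
  have "S \<subseteq> (\<Union>j\<in>D. X j)"
  proof
    fix x assume "x \<in> S"
    then obtain B where B: "B \<in> \<B>" "x \<in> B" using \<B> by blast
    then obtain j where "j \<in> {1..N}" "B = X j" using \<B>(1) im by blast
    then show "x \<in> (\<Union>j\<in>D. X j)" using B \<B>(2) by (auto simp: D_def)
  qed
  then have DS: "S = (\<Union>j\<in>D. X j)" by (auto simp: D_def)
  have uniq: "D' = D" if D': "D' \<subseteq> {1..N}" "S = (\<Union>j\<in>D'. X j)" for D'
  proof
    show "D' \<subseteq> D" using D' by (auto simp: D_def)
    show "D \<subseteq> D'"
    proof
      fix j assume j: "j \<in> D"
      have "X j \<in> X ` D'"
      proof (rule basis_hyperbox_subset_Union)
        show "X j \<in> basis_hyperboxes P" "X ` D' \<subseteq> basis_hyperboxes P"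
          using j D'(1) im by (auto simp: D_def)
        show "X j \<subseteq> \<Union>(X ` D')"
          using j D'(2) by (simp add: D_def)
      qed
      then obtain i where "i \<in> D'" "X j = X i" by blast
      moreover have "j \<in> {1..N}" "i \<in> {1..N}"
        using j D'(1) \<open>i \<in> D'\<close> by (auto simp: D_def)
      ultimately show "j \<in> D'"
        using inj_onD[OF inj] by metis
    qed
  qed
  have "index_set X N S = D"
    unfolding index_set_def
  proof (rule the_equality)
    show "D \<subseteq> {1..N} \<and> S = (\<Union>j\<in>D. X j)"
      using DS by (intro conjI) (auto simp only: D_def)
  qed (use uniq in blast)
  moreover have "{B \<in> basis_hyperboxes P. B \<subseteq> S} = X ` D"
    unfolding D_def im[symmetric] by blast
  moreover have "card (X ` D) = card D"
    by (rule card_image) (rule inj_on_subset[OF inj], auto simp: D_def)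
  ultimately show ?thesis by (simp add: count_def)
qed

subsection \<open>Invariants and ranking\<close>

definition quantized_within :: "real vec set \<Rightarrow> hyperbox list \<Rightarrow> bool" where
  "quantized_within S Is \<longleftrightarrow> (\<forall>I\<in>set Is. quantized_hyperbox P I \<and> box_set I \<subseteq> S)"

lemma quantized_within_self:
  "quantized_within S Is \<Longrightarrow> quantized_within (list_set Is) Is"
  by (auto simp: quantized_within_def list_set_def)

lemma list_set_subset: "quantized_within S Is \<Longrightarrow> list_set Is \<subseteq> S"
  by (auto simp: quantized_within_def list_set_def)

definition Q_inv :: "real vec set \<Rightarrow> Q_state \<Rightarrow> bool" where
  "Q_inv S s \<longleftrightarrow> quantized_within S (fst s) \<and> quantized_within S (snd s)"

lemma Q_inv_init: "quantized_within S Is \<Longrightarrow> Q_inv S (Q_init P obs Is)"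
  by (auto simp: Q_inv_def Q_init_def quantized_within_def)

lemma refine_list_quantized_within:
  assumes "quantized_within S Is" "refine_list P Is Js"
  shows "quantized_within S Js"
  using assms refine_list_mem unfolding quantized_within_def by (meson order.trans psubset_imp_subset)

lemma Q_inv_step:
  assumes "Q_step P obs s s'" "Q_inv S s"
  shows "Q_inv S s'"
  using assms
proof cases
  case (1 Neg Js R)
  then have "quantized_within S Js"
    using assms(2) by (auto simp: Q_inv_def intro: refine_list_quantized_within)
  then show ?thesis
    using 1 assms(2) by (auto simp: Q_inv_def quantized_within_def)
qed

lemma Q_inv_steps: "(Q_step P obs)\<^sup>*\<^sup>* s s' \<Longrightarrow> Q_inv S s \<Longrightarrow> Q_inv S s'"
  by (induction rule: rtranclp_induct) (auto intro: Q_inv_step)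

text \<open>A maximum rather than a sum, since the counts of two halves can add up to that of the
  box they replace. The inserted 0 is the rank of an empty list.\<close>

definition Q_rank :: "Q_state \<Rightarrow> nat" where
  "Q_rank s = Max (insert 0 ((\<lambda>I. count (box_set I)) ` set (snd s)))"

text \<open>Each new box lies properly inside an old one before verification is even consulted, so
  its count is below the old maximum.\<close>

lemma Q_rank_step:
  assumes "Q_step P obs s s'" "Q_inv S s"
  shows "Q_rank s' < Q_rank s"
  using assms(1)
proof cases
  case (1 Neg Js R)
  have q: "quantized_hyperbox P I" if "I \<in> set Neg" for I
    using that 1(1) assms(2) by (auto simp: Q_inv_def quantized_within_def)
  have le: "count (box_set I) \<le> Q_rank s" if "I \<in> set Neg" for I
    using that by (auto simp: 1(1) Q_rank_def intro!: Max_ge)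
  \<comment> \<open>The new list may be empty, with rank 0, so positivity is needed
    separately.\<close>
  have "0 < Q_rank s"
    using 1(3) q le count_quantized_pos by (metis gr0I leD list.set_intros(1) neq_Nil_conv)
  moreover have "count (box_set J) < Q_rank s" if J: "J \<in> set Js" for J
  proof -
    obtain I where I: "I \<in> set Neg" "box_set J \<subset> box_set I"
      using refine_list_mem[OF 1(4) J] by blast
    have "count (box_set J) < count (box_set I)"
      using I(2) q[OF I(1)] by (intro count_strict_mono) (auto simp: quantized_hyperbox_def)
    then show ?thesis using le[OF I(1)] by linarith
  qed
  ultimately show ?thesis
    by (subst Q_rank_def) (auto simp: 1(2))
qed

text \<open>\<open>c\<close> is a fixed budget for completed iterations plus remaining cells. A
  stopped run gets one more, for the evaluation that detects the repetition.\<close>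

fun config_inv :: "nat \<Rightarrow> config \<Rightarrow> bool" where
  "config_inv c (Recursion i A) \<longleftrightarrow>
     quantized_within (list_set A) A \<and> i + count (list_set A) \<le> c"
| "config_inv c (Evaluation i A obs s) \<longleftrightarrow>
     quantized_within (list_set A) A \<and> i + count (list_set A) \<le> c \<and> Q_inv (list_set A) s"
| "config_inv c (Stopped N C) \<longleftrightarrow> N \<le> Suc c"

lemma count_decrease:
  assumes "quantized_within S A" "quantized_within (list_set A) R" "list_set R \<noteq> list_set A"
  shows "count (list_set R) < count (list_set A)"
proof (rule count_strict_mono)
  show "list_set R \<subset> list_set A"
    using list_set_subset[OF assms(2)] assms(3) by blast
  show "list_set A \<in> unions_of_basis P"
    using assms(1) by (intro list_set_in_unions) (auto simp: quantized_within_def)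
qed

lemma config_inv_step:
  assumes "cis_step P x y" "config_inv c x"
  shows "config_inv c y"
  using assms
proof cases
  case (continue R A i obs)
  then have "quantized_within (list_set A) A" "quantized_within (list_set A) R"
    "i + count (list_set A) \<le> c"
    using assms(2) by (auto simp: Q_inv_def)
  then show ?thesis
    using continue count_decrease[of "list_set A" A R] quantized_within_self by auto
qed (auto intro: Q_inv_init Q_inv_step)

lemma config_inv_steps: "(cis_step P)\<^sup>*\<^sup>* x y \<Longrightarrow> config_inv c x \<Longrightarrow> config_inv c y"
  by (induction rule: rtranclp_induct) (auto intro: config_inv_step)

text \<open>Ordered lexicographically: remaining cells, phase, progress inside an evaluation.
  Continuing raises the phase but loses a cell; starting an evaluation lowers the phase, so its
  initial \<open>Q_rank\<close> may be arbitrary.\<close>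

fun config_rank :: "config \<Rightarrow> nat \<times> nat \<times> nat" where
  "config_rank (Recursion i A) = (count (list_set A), 2, 0)"
| "config_rank (Evaluation i A obs s) = (count (list_set A), 1, Q_rank s)"
| "config_rank (Stopped N C) = (count (list_set C), 0, 0)"

lemma config_rank_step:
  assumes "cis_step P x y" "config_inv c x"
  shows "(config_rank y, config_rank x) \<in> less_than <*lex*> less_than <*lex*> less_than"
  using assms
proof cases
  case (loop_Q obs s s' i A)
  then show ?thesis
    using assms(2) Q_rank_step[of obs s s' "list_set A"] by auto
next
  case (continue R A i obs)
  then show ?thesis
    using assms(2) count_decrease[of "list_set A" A R] by (auto simp: Q_inv_def)
qed auto

section \<open>Termination and progress of runs\<close>

lemma no_infinite_run:
  assumes "config_inv c (run 0)"
  shows "\<not> (\<forall>t. cis_step P (run t) (run (Suc t)))"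
proof
  assume run: "\<forall>t. cis_step P (run t) (run (Suc t))"
  have inv: "config_inv c (run t)" for t
    by (induction t) (use assms run config_inv_step in blast)+
  have "wf (less_than <*lex*> less_than <*lex*> less_than)"
    by (intro wf_lex_prod wf_less_than)
  then have "\<not> (\<forall>t. (config_rank (run (Suc t)), config_rank (run t))
      \<in> less_than <*lex*> less_than <*lex*> less_than)"
    unfolding wf_iff_no_infinite_down_chain by (elim contrapos_nn) (rule exI)
  then show False
    using config_rank_step run inv by blast
qed

text \<open>A target always has a representation, a non-empty list always has a refinement, and with
  an empty list \<open>continue\<close> and \<open>stop\<close> exhaust the cases.\<close>

lemma progress:
  assumes "config_inv c x"
  shows "(\<exists>y. cis_step P x y) \<or> (\<exists>N C. x = Stopped N C)"
proof (cases x)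
  case (Recursion i A)
  then have "\<forall>I\<in>set A. quantized_hyperbox P I"
    using assms by (auto simp: quantized_within_def)
  then have "\<exists>obs. represents_target P obs (list_set A)"
    using state_box_hyperbox quantized_subset_state_box
    by (intro represents_target_exists) (auto simp: quantized_hyperbox_def list_set_def)
  then show ?thesis
    using Recursion by (blast intro: start_Q)
next
  case (Evaluation i A obs s)
  obtain R Neg where s: "s = (R, Neg)" by fastforce
  show ?thesis
  proof (cases "Neg = []")
    case True
    then show ?thesis
      using Evaluation s continue stop by metis
  next
    case False
    have "\<exists>Js. refine_list P Neg Js"
      using assms Evaluation s
      by (intro refine_list_exists) (auto simp: Q_inv_def quantized_within_def)
    then show ?thesis
      using False Evaluation s by (blast intro: loop_Q Q_step.intros)
  qed
qed simp

lemma Q_returns_quantized_within: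
  assumes "Q_returns P A T R" "quantized_within S A"
  shows "quantized_within (list_set A) R"
proof -
  obtain obs where "(Q_step P obs)\<^sup>*\<^sup>* (Q_init P obs A) (R, [])"
    using assms(1) by (auto simp: Q_returns_def)
  then have "Q_inv (list_set A) (R, [])"
    using assms(2) by (blast intro: Q_inv_steps Q_inv_init quantized_within_self)
  then show ?thesis by (simp add: Q_inv_def)
qed

text \<open>Without a repetition every iteration loses at least one cell.\<close>

lemma recursion_stationary:
  assumes "quantized_within (list_set (A 0)) (A 0)"
    and "\<forall>i. Q_returns P (A i) (list_set (A i)) (A (Suc i))"
  shows "\<exists>i\<le>count (list_set (A 0)). list_set (A (Suc i)) = list_set (A i)"
proof (rule ccontr)
  assume neq: "\<not> ?thesis"
  have q: "quantized_within (list_set (A i)) (A i)" for i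
    by (induction i) (use assms Q_returns_quantized_within quantized_within_self in blast)+
  \<comment> \<open>The range reaches one index beyond those where a repetition is excluded; there
    the inequality is already absurd.\<close>
  have "i + count (list_set (A i)) \<le> count (list_set (A 0))"
    if "i \<le> Suc (count (list_set (A 0)))" for i
    using that
  proof (induction i)
    case (Suc i)
    then have "count (list_set (A (Suc i))) < count (list_set (A i))"
      using neq assms(2) q by (intro count_decrease) (auto intro: Q_returns_quantized_within)
    then show ?case using Suc by simp
  qed simp
  from this[OF order.refl] show False by simp
qed

end

theorem mainTheorem12:
  fixes P :: nn_system
    and X\<^sub>s X\<^sub>s\<^sub>\<Delta> :: "real vec set"
    and safe_boxes :: "hyperbox list"
    and X\<^sub>\<Delta> :: "nat \<Rightarrow> real vec set"
    and n\<^sub>\<Delta> N\<^sub>T :: nat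
  assumes "nn_system_wf P"
    and "X\<^sub>s \<subseteq> box_set (state_box P)"
    and "vec_interior (n_x P) X\<^sub>s \<noteq> {}"
    and "bij_betw X\<^sub>\<Delta> {1..n\<^sub>\<Delta>} (basis_hyperboxes P)"
    and "\<forall>I\<in>set safe_boxes. quantized_hyperbox P I \<and> box_set I \<subseteq> X\<^sub>s"
    and "X\<^sub>s\<^sub>\<Delta> = list_set safe_boxes"
    and "N\<^sub>T = card (index_set X\<^sub>\<Delta> n\<^sub>\<Delta> X\<^sub>s\<^sub>\<Delta>) + 1"
  shows
    "\<comment> \<open>no run is infinite\<close>
     (\<nexists>run. run 0 = Recursion 0 safe_boxes \<and> (\<forall>t. cis_step P (run t) (run (Suc t)))) \<and>
     \<comment> \<open>a run can only end by stopping regularly\<close>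
     (\<forall>c. (cis_step P)\<^sup>*\<^sup>* (Recursion 0 safe_boxes) c \<longrightarrow>
       (\<exists>c'. cis_step P c c') \<or> (\<exists>N C. c = Stopped N C)) \<and>
     \<comment> \<open>number of evaluations of \<open>\<Q>\<close> until the stop\<close>
     (\<forall>N C. (cis_step P)\<^sup>*\<^sup>* (Recursion 0 safe_boxes) (Stopped N C) \<longrightarrow> N \<le> N\<^sub>T) \<and>
     \<comment> \<open>any sequence following the recursion meets the stopping criterion within \<open>N\<^sub>T\<close> iterations\<close>
     (\<forall>A. A 0 = safe_boxes \<and> (\<forall>i. Q_returns P (A i) (list_set (A i)) (A (Suc i))) \<longrightarrow>
       (\<exists>i. Suc i \<le> N\<^sub>T \<and> list_set (A (Suc i)) = list_set (A i)))"
proof -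
  interpret quantized_system P by unfold_locales (rule assms(1))
  have q: "quantized_within (list_set safe_boxes) safe_boxes"
    using assms(5) by (auto simp: quantized_within_def list_set_def)
  \<comment> \<open>The successor accounts for the last evaluation, which only detects the
    repetition.\<close>
  have N: "N\<^sub>T = Suc (count (list_set safe_boxes))"
    using card_index_set[OF assms(4) list_set_in_unions] assms(5-7) by simp
  have inv: "config_inv (count (list_set safe_boxes)) (Recursion 0 safe_boxes)"
    using q by simp
  show ?thesis
  proof (intro conjI allI impI)
    show "\<nexists>run. run 0 = Recursion 0 safe_boxes \<and> (\<forall>t. cis_step P (run t) (run (Suc t)))"
      using no_infinite_run inv by metis
  next
    fix c assume "(cis_step P)\<^sup>*\<^sup>* (Recursion 0 safe_boxes) c"
    then show "(\<exists>c'. cis_step P c c') \<or> (\<exists>N C. c = Stopped N C)"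
      using config_inv_steps inv progress by blast
  next
    fix N C assume "(cis_step P)\<^sup>*\<^sup>* (Recursion 0 safe_boxes) (Stopped N C)"
    from config_inv_steps[OF this inv] show "N \<le> N\<^sub>T"
      by (simp add: N)
  next
    fix A assume "A 0 = safe_boxes \<and> (\<forall>i. Q_returns P (A i) (list_set (A i)) (A (Suc i)))"
    then show "\<exists>i. Suc i \<le> N\<^sub>T \<and> list_set (A (Suc i)) = list_set (A i)"
      using recursion_stationary[of A] q unfolding N by auto
  qed
qed

end
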